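(* Let $n \geq 1$ and let $1 \leq k_1 \leq k_2 \leq \dots \leq k_n$ be integers. Then $\mathcal{L}_{(k_1,\dots,k_n),\leq n}$ has the star property at $\{(1,1)\}$.
   Context: All sets and families (sets of sets) are finite; $[n] = \{1,\dots,n\}$ and $\binom{[n]}{r}$ is the family of $r$-element subsets of $[n]$. For positive integers $k_1 \leq \dots \leq k_n$, $\mathbf{k} = (k_1,\dots,k_n)$ and $r \in [n]$, define $$\mathcal{L}_{\mathbf{k},r} := \left\{\{(x_1,y_{x_1}), \dots, (x_r,y_{x_r})\} \colon \{x_1,\dots,x_r\} \in \binom{[n]}{r},\ y_{x_i} \in \{1,\dots,k_{x_i}\} \text{ for each } i \in [r]\right\},$$ let $\mathcal{L}_{\mathbf{k},0} := \{\emptyset\}$, and let $\mathcal{L}_{\mathbf{k},\leq n} := \bigcup_{i=0}^{n} \mathcal{L}_{\mathbf{k},i}$ (so $\mathcal{L}_{\mathbf{k},\leq n}$ is the family of all subsets of the sets $\{(1,y_1),\dots,(n,y_n)\}$ with $y_i \in \{1,\dots,k_i\}$). A family $\mathcal{A}$ is intersecting if $A \cap B \neq \emptyset$ for any $A, B \in \mathcal{A}$ (the case $A=B$ included, so $\emptyset \notin \mathcal{A}$). For a family $\mathcal{F}$ and a set $S$, $\mathcal{F}(S) := \{F \in \mathcal{F} \colon S \subseteq F\}$. The family $\mathcal{F}$ has the star property at the $1$-element set $\{x\}$ if $\mathcal{F}(\{x\})$ is a largest intersecting sub-family of $\mathcal{F}$, i.e. no intersecting sub-family of $\mathcal{F}$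 has more sets than $\mathcal{F}(\{x\})$. *)

theory Defs
  imports Main
begin

text \<open>
  The tuple \<open>(k\<^sub>1, ..., k\<^sub>n)\<close> is a function \<open>k\<close> read only on the index set
  \<open>{1..n}\<close>; its length \<open>n\<close> is passed separately.
  A labelled set is the graph over \<open>X\<close> of a choice of labels \<open>y\<close>. For \<open>r = 0\<close> the definition
  yields the family \<open>{{}}\<close>, see \<open>labelled_sets_0\<close> below.
\<close>

definition labelled_sets :: "nat \<Rightarrow> (nat \<Rightarrow> nat) \<Rightarrow> nat \<Rightarrow> (nat \<times> nat) set set" where
  "labelled_sets n k r =
     {(\<lambda>x. (x, y x)) ` X | X y. X \<subseteq> {1..n} \<and> card X = r \<and> (\<forall>x\<in>X. y x \<in> {1..k x})}"

definition labelled_sets_upto :: "nat \<Rightarrow> (nat \<Rightarrow> nat) \<Rightarrow> (nat \<times> nat) set set" where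
  "labelled_sets_upto n k = (\<Union>r\<in>{0..n}. labelled_sets n k r)"

text \<open>The case \<open>A = B\<close> is included, so an intersecting family does not contain the empty set.\<close>

definition intersecting :: "'a set set \<Rightarrow> bool" where
  "intersecting \<A> \<longleftrightarrow> (\<forall>A\<in>\<A>. \<forall>B\<in>\<A>. A \<inter> B \<noteq> {})"

definition star :: "'a set set \<Rightarrow> 'a set \<Rightarrow> 'a set set" where
  "star \<F> S = {F \<in> \<F>. S \<subseteq> F}"

text \<open>
  Sizes are compared by \<open>card\<close>, so this is meaningful for finite families only;
  \<open>finite_labelled_sets_upto\<close> below shows that the families considered here are finite.
\<close>

definition star_property :: "'a set set \<Rightarrow> 'a set \<Rightarrow> bool" where
  "star_property \<F> S \<longleftrightarrow>
     intersecting (star \<F> S) \<and>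
     (\<forall>\<A>. \<A> \<subseteq> \<F> \<and> intersecting \<A> \<longrightarrow> card \<A> \<le> card (star \<F> S))"

lemma labelled_sets_0: "labelled_sets n k 0 = {{}}"
proof
  show "labelled_sets n k 0 \<subseteq> {{}}"
  proof
    fix F assume "F \<in> labelled_sets n k 0"
    then obtain X y where F: "F = (\<lambda>x. (x, y x)) ` X" and X: "X \<subseteq> {1..n}" "card X = 0"
      unfolding labelled_sets_def by blast
    have "finite X"
      using X(1) finite_atLeastAtMost by (rule finite_subset)
    with X(2) have "X = {}" by simp
    with F show "F \<in> {{}}" by simp
  qed
  show "{{}} \<subseteq> labelled_sets n k 0"
    unfolding labelled_sets_def by simp
qed

lemma finite_labelled_sets_upto: "finite (labelled_sets_upto n k)"
proof (rule finite_subset)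
  show "labelled_sets_upto n k \<subseteq> Pow (SIGMA x:{1..n}. {1..k x})"
  proof
    fix F assume "F \<in> labelled_sets_upto n k"
    then obtain X y where F: "F = (\<lambda>x. (x, y x)) ` X"
      and X: "X \<subseteq> {1..n}" and y: "\<forall>x\<in>X. y x \<in> {1..k x}"
      unfolding labelled_sets_upto_def labelled_sets_def by blast
    show "F \<in> Pow (SIGMA x:{1..n}. {1..k x})"
      unfolding F using X y by blast
  qed
  show "finite (Pow (SIGMA x:{1..n}. {1..k x}))" by simp
qed

end

(* Encode a labelled set as a function f on {1..n} with values f i in {0..k i}, where 0 means that
   i is not used. Modulo k i + 1, adding a constant t to all values permutes these functions. Since
   k 1 is the smallest of the k i, the translates by distinct t in {0..k 1} of two functions that
   agree somewhere are different. So the k 1 + 1 translates of an intersecting family are disjoint,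
   and the family occupies at most the fraction 1 / (k 1 + 1) of the whole, which is what the star
   at (1, 1) occupies. *)
theory Submission
  imports Defs "HOL-Library.FuncSet"
begin

definition labelling_graph :: "nat \<Rightarrow> (nat \<Rightarrow> nat) \<Rightarrow> (nat \<times> nat) set" where
  "labelling_graph n f = (\<lambda>i. (i, f i)) ` {i \<in> {1..n}. f i \<noteq> 0}"

text \<open>Extensionality fixes the values outside \<open>{1..n}\<close>, which is what makes
  \<open>labelling_graph\<close> injective here.\<close>

definition labellings :: "nat \<Rightarrow> (nat \<Rightarrow> nat) \<Rightarrow> (nat \<Rightarrow> nat) set" where
  "labellings n k = (\<Pi>\<^sub>E i\<in>{1..n}. {0..k i})"

definition translate :: "nat \<Rightarrow> (nat \<Rightarrow> nat) \<Rightarrow> nat \<Rightarrow> (nat \<Rightarrow> nat) \<Rightarrow> (nat \<Rightarrow> nat)" where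
  "translate n k t f = (\<lambda>i\<in>{1..n}. (t + f i) mod (k i + 1))"

lemma mem_labelling_graph_iff:
  "(i, v) \<in> labelling_graph n f \<longleftrightarrow> i \<in> {1..n} \<and> f i = v \<and> v \<noteq> 0"
  unfolding labelling_graph_def by auto

lemma labellings_eqI:
  assumes "f \<in> labellings n k" "g \<in> labellings n k" "\<And>i. i \<in> {1..n} \<Longrightarrow> f i = g i"
  shows "f = g"
  using assms unfolding labellings_def by (rule PiE_ext)

text \<open>In the union over \<open>r\<close> the condition on \<open>card X\<close> drops out,
  because every subset of \<open>{1..n}\<close> has at most \<open>n\<close> elements.\<close>

lemma mem_labelled_sets_upto_iff:
  "F \<in> labelled_sets_upto n k \<longleftrightarrow>
     (\<exists>X y. F = (\<lambda>x. (x, y x)) ` X \<and> X \<subseteq> {1..n} \<and> (\<forall>x\<in>X. y x \<in> {1..k x}))"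
proof -
  have "card X \<in> {0..n}" if "X \<subseteq> {1..n}" for X
    using card_mono[OF _ that] by simp
  then show ?thesis
    unfolding labelled_sets_upto_def labelled_sets_def UN_iff mem_Collect_eq by blast
qed

lemma inj_on_labelling_graph: "inj_on (labelling_graph n) (labellings n k)"
proof (rule inj_onI)
  fix f g
  assume f: "f \<in> labellings n k" and g: "g \<in> labellings n k"
    and eq: "labelling_graph n f = labelling_graph n g"
  have "f i = g i" if i: "i \<in> {1..n}" for i
  proof -
    \<comment> \<open>The graph records exactly the nonzero values; an index missing from it has
      value 0 under both functions.\<close>
    have "f i = v \<longleftrightarrow> g i = v" if "v \<noteq> 0" for v
      using i that eq mem_labelling_graph_iff by blast
    then show ?thesis by metis
  qed
  then show "f = g"
    using f g by (intro labellings_eqI)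
qed

lemma labelling_graph_image: "labelling_graph n ` labellings n k = labelled_sets_upto n k"
proof (intro equalityI subsetI)
  fix F assume "F \<in> labelling_graph n ` labellings n k"
  then obtain f where f: "f \<in> labellings n k" and F: "F = labelling_graph n f"
    by blast
  have "\<forall>i\<in>{i \<in> {1..n}. f i \<noteq> 0}. f i \<in> {1..k i}"
    using f unfolding labellings_def by (auto simp: PiE_iff)
  then show "F \<in> labelled_sets_upto n k"
    unfolding F labelling_graph_def mem_labelled_sets_upto_iff
    by (intro exI[of _ "{i \<in> {1..n}. f i \<noteq> 0}"] exI[of _ f]) auto
next
  fix F assume "F \<in> labelled_sets_upto n k"
  then obtain X y where F: "F = (\<lambda>x. (x, y x)) ` X"
    and X: "X \<subseteq> {1..n}" and y: "\<forall>x\<in>X. y x \<in> {1..k x}"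
    unfolding mem_labelled_sets_upto_iff by blast
  \<comment> \<open>Indices outside \<open>X\<close> get 0. As labels are at least 1, the support of
    \<open>f\<close> is exactly \<open>X\<close>.\<close>
  define f where "f = (\<lambda>i\<in>{1..n}. if i \<in> X then y i else 0)"
  have "f \<in> labellings n k"
    using y unfolding labellings_def f_def by auto
  moreover have "{i \<in> {1..n}. f i \<noteq> 0} = X"
    using X y unfolding f_def by (auto split: if_splits)
  moreover have "(\<lambda>i. (i, f i)) ` X = F"
    unfolding F f_def using X by (intro image_cong) auto
  ultimately show "F \<in> labelling_graph n ` labellings n k"
    unfolding labelling_graph_def by (intro image_eqI[of _ _ f]) auto
qed

lemma finite_labellings: "finite (labellings n k)"
  unfolding labellings_def by (intro finite_PiE) auto

lemma translate_in_labellings: "translate n k t f \<in> labellings n k"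
  unfolding translate_def labellings_def by (auto simp: less_Suc_eq_le[symmetric])

lemma mod_add_left_cancel_nat:
  fixes m s t v :: nat
  assumes "(v + s) mod m = (v + t) mod m" "s < m" "t < m"
  shows "s = t"
proof -
  \<comment> \<open>Multiples of \<open>m\<close> on both sides express the congruence without
    subtraction, so \<open>v\<close> can be cancelled.\<close>
  obtain q r where "v + s + m * q = v + t + m * r"
    using assms(1) nat_mod_eq_iff by blast
  then have "(s + m * q) mod m = (t + m * r) mod m"
    by simp
  then show ?thesis
    using assms(2,3) by simp
qed

lemma card_pairwise_agreeing_le:
  assumes sub: "B \<subseteq> labellings n k"
    and agree: "\<And>f g. f \<in> B \<Longrightarrow> g \<in> B \<Longrightarrow> \<exists>i\<in>{1..n}. f i = g i"
    and le: "\<And>i. i \<in> {1..n} \<Longrightarrow> m \<le> k i"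
  shows "(m + 1) * card B \<le> card (labellings n k)"
proof -
  \<comment> \<open>Injectivity on pairs says two things at once: each translation is injective on
    \<open>B\<close>, and translates of \<open>B\<close> by distinct shifts are disjoint.\<close>
  have "inj_on (\<lambda>(t, f). translate n k t f) ({0..m} \<times> B)"
  proof (rule inj_onI, clarify)
    fix s t f g
    assume s: "s \<in> {0..m}" and t: "t \<in> {0..m}" and f: "f \<in> B" and g: "g \<in> B"
      and eq: "translate n k s f = translate n k t g"
    have mod_eq: "(s + f i) mod (k i + 1) = (t + g i) mod (k i + 1)" if "i \<in> {1..n}" for i
      using fun_cong[OF eq, of i] that unfolding translate_def by simp
    obtain i where i: "i \<in> {1..n}" and fg: "f i = g i"
      using agree[OF f g] by blast
    \<comment> \<open>The common value at \<open>i\<close> cancels, and distinct shifts in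
      \<open>{0..m}\<close> stay distinct modulo \<open>k i + 1\<close> because
      \<open>m \<le> k i\<close>.\<close>
    have st: "s = t"
    proof (rule mod_add_left_cancel_nat)
      show "(f i + s) mod (k i + 1) = (f i + t) mod (k i + 1)"
        using mod_eq[OF i] fg by (simp add: add.commute)
      show "s < k i + 1" "t < k i + 1"
        using s t le[OF i] by auto
    qed
    \<comment> \<open>Now the common shift cancels at every index, since the values are already
      reduced modulo \<open>k j + 1\<close>.\<close>
    have "f j = g j" if j: "j \<in> {1..n}" for j
    proof (rule mod_add_left_cancel_nat)
      show "(s + f j) mod (k j + 1) = (s + g j) mod (k j + 1)"
        using mod_eq[OF j] st by simp
      show "f j < k j + 1" "g j < k j + 1"
        using f g sub j unfolding labellings_def by (auto simp: PiE_iff less_Suc_eq_le)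
    qed
    then have "f = g"
      using f g sub by (intro labellings_eqI[of f n k g]) auto
    with st show "s = t \<and> f = g" by simp
  qed
  moreover have "(\<lambda>(t, f). translate n k t f) ` ({0..m} \<times> B) \<subseteq> labellings n k"
    using translate_in_labellings by auto
  ultimately have "card ({0..m} \<times> B) \<le> card (labellings n k)"
    using finite_labellings by (rule card_inj_on_le)
  then show ?thesis
    by (simp add: card_cartesian_product)
qed

text \<open>Prescribing an admissible value at \<open>j\<close> turns the factor
  \<open>k j + 1\<close> of the product into 1.\<close>

lemma card_labellings_fixed_value:
  assumes j: "j \<in> {1..n}" and v: "v \<le> k j"
  shows "(k j + 1) * card {f \<in> labellings n k. f j = v} = card (labellings n k)"
proof -
  have "{f \<in> labellings n k. f j = v} = (\<Pi>\<^sub>E i\<in>{1..n}. if i = j then {v} else {0..k i})"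
    using j v unfolding labellings_def by (fastforce simp: PiE_iff split: if_splits)
  then have "card {f \<in> labellings n k. f j = v} =
      (\<Prod>i\<in>{1..n}. card (if i = j then {v} else {0..k i}))"
    by (simp add: card_PiE)
  also have "\<dots> = (\<Prod>i\<in>{1..n} - {j}. k i + 1)"
    using j by (subst prod.remove[of _ j]) (auto intro!: prod.cong)
  finally have "card {f \<in> labellings n k. f j = v} = (\<Prod>i\<in>{1..n} - {j}. k i + 1)" .
  moreover have "card (labellings n k) = (\<Prod>i\<in>{1..n}. k i + 1)"
    unfolding labellings_def by (simp add: card_PiE)
  ultimately show ?thesis
    using prod.remove[OF _ j, of "\<lambda>i. k i + 1"] by simp
qed

theorem theorem5p6:
  fixes n :: nat and k :: "nat \<Rightarrow> nat"
  assumes "1 \<le> n"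
    and "1 \<le> k 1"
    and "mono_on {1..n} k"
  shows "star_property (labelled_sets_upto n k) {(1, 1)}"
proof -
  let ?F = "labelled_sets_upto n k"
  let ?S = "star ?F {(1, 1)}"
  have card_preimage: "card {f \<in> labellings n k. labelling_graph n f \<in> \<A>} = card \<A>"
    if "\<A> \<subseteq> ?F" for \<A>
  proof -
    let ?B = "{f \<in> labellings n k. labelling_graph n f \<in> \<A>}"
    have "inj_on (labelling_graph n) ?B"
      using inj_on_labelling_graph by (rule inj_on_subset) auto
    moreover have "\<A> \<subseteq> labelling_graph n ` labellings n k"
      using that labelling_graph_image by simp
    then have "labelling_graph n ` ?B = \<A>"
      by auto
    ultimately show ?thesis
      using card_image[of "labelling_graph n" ?B] by simp
  qed
  have "{f \<in> labellings n k. labelling_graph n f \<in> ?S} = {f \<in> labellings n k. f 1 = 1}"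
    using labelling_graph_image[of n k] assms(1)
    by (auto simp: star_def mem_labelling_graph_iff)
  \<comment> \<open>The star corresponds to the slice \<open>f 1 = 1\<close> of the product;
    \<open>1 \<le> k 1\<close> makes the label 1 admissible.\<close>
  then have card_star: "(k 1 + 1) * card ?S = card (labellings n k)"
    using card_preimage[of ?S] card_labellings_fixed_value[of 1 n 1 k] assms(1,2)
    by (simp add: star_def)
  have "card \<A> \<le> card ?S" if sub: "\<A> \<subseteq> ?F" and int: "intersecting \<A>" for \<A>
  proof -
    let ?B = "{f \<in> labellings n k. labelling_graph n f \<in> \<A>}"
    have "(k 1 + 1) * card ?B \<le> card (labellings n k)"
    proof (rule card_pairwise_agreeing_le)
      show "\<exists>i\<in>{1..n}. f i = g i" if "f \<in> ?B" "g \<in> ?B" for f g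
      proof -
        \<comment> \<open>A common pair \<open>(i, v)\<close> of the two graphs forces
          \<open>f i = v = g i\<close>.\<close>
        have "labelling_graph n f \<inter> labelling_graph n g \<noteq> {}"
          using int that unfolding intersecting_def by blast
        then show ?thesis
          unfolding labelling_graph_def by auto
      qed
      show "k 1 \<le> k i" if "i \<in> {1..n}" for i
        using mono_onD[OF assms(3), of 1 i] assms(1) that by simp
    qed auto
    then have "(k 1 + 1) * card \<A> \<le> (k 1 + 1) * card ?S"
      unfolding card_star card_preimage[OF sub] .
    then show ?thesis
      unfolding mult_le_cancel1 by simp
  qed
  \<comment> \<open>It remains that the star is intersecting: all its members contain
    \<open>(1, 1)\<close>.\<close>
  then show ?thesis
    unfolding star_property_def intersecting_def star_def by auto
qed

end
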